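(* Let $k\in\mathbb{N}$ with $k\ge 2$, let $n=(k+1)^2-1$, and let $T\in\operatorname{YT}(n)$ have shape $((k+1)^k,k)$. Then $\operatorname{M}_k(T)$ determines the location of $n$ in $T$.
   Context: A (standard Young) tableau of shape $\lambda$ (a partition of $n$) is a filling of the Young diagram of $\lambda$ by distinct elements of $[1,n]$ increasing strictly along rows and down columns; $\operatorname{YT}(n)$ is the set of such tableaux with entries exactly $[1,n]$. The shape $((k+1)^k,k)$ is a $(k+1)\times(k+1)$ square with its lower-right cell removed. Deletion by jeu de taquin: for $T\in\operatorname{YT}(n)$ and an entry $m$, delete the cell containing $m$; repeatedly, if there is a cell directly to the right of or directly below the empty space, slide the one with the smaller entry into it; stop when neither exists; then subtract 1 from every entry larger than $m$, giving $T-m\in\operatorname{YT}(n-1)$. A $k$-minor of $T$ is a tableau obtained by $k$ successive such deletions; $\operatorname{M}_k(T)$ is the set of all $k$-minors. "Determined by $\operatorname{M}_k(T)$" means: any $S\in\operatorname{YT}(n)$ of the same shape with $\operatorname{M}_k(S)=\operatorname{M}_k(T)$ has $n$ in the same cell as $T$. *)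

theory Defs
  imports Main
begin

text \<open>
  Cells are pairs (row, column), counted from 0, with rows numbered downwards.  A filling is a
  partial map from cells to entries; its domain is the set of filled cells.
\<close>

type_synonym cell = "nat \<times> nat"
type_synonym filling = "cell \<rightharpoonup> nat"

definition is_partition :: "nat list \<Rightarrow> nat \<Rightarrow> bool" where
  "is_partition lam n \<longleftrightarrow> sorted_wrt (\<ge>) lam \<and> 0 \<notin> set lam \<and> sum_list lam = n"

definition young_diagram :: "nat list \<Rightarrow> cell set" where
  "young_diagram lam = {(i, j). i < length lam \<and> j < lam ! i}"

definition has_shape :: "filling \<Rightarrow> nat list \<Rightarrow> bool" where
  "has_shape T lam \<longleftrightarrow> dom T = young_diagram lam"

definition rows_increasing :: "filling \<Rightarrow> bool" where
  "rows_increasing T \<longleftrightarrow>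
     (\<forall>i j j' a b. T (i, j) = Some a \<longrightarrow> T (i, j') = Some b \<longrightarrow> j < j' \<longrightarrow> a < b)"

definition columns_increasing :: "filling \<Rightarrow> bool" where
  "columns_increasing T \<longleftrightarrow>
     (\<forall>i i' j a b. T (i, j) = Some a \<longrightarrow> T (i', j) = Some b \<longrightarrow> i < i' \<longrightarrow> a < b)"

definition YT :: "nat \<Rightarrow> filling set" where
  "YT n = {T. (\<exists>lam. is_partition lam n \<and> has_shape T lam)
              \<and> inj_on T (dom T) \<and> ran T = {1..n}
              \<and> rows_increasing T \<and> columns_increasing T}"

text \<open>
  The argument \<open>(i, j)\<close> of \<open>slide\<close> is the current empty cell, so \<open>T (i, j) = None\<close> is intended.
  The recursion terminates for finite fillings; no claim is made about infinite ones.
\<close>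

partial_function (tailrec) slide :: "filling \<Rightarrow> nat \<Rightarrow> nat \<Rightarrow> filling" where
  "slide T i j =
     (case (T (i, Suc j), T (Suc i, j)) of
        (None, None) \<Rightarrow> T
      | (Some a, None) \<Rightarrow> slide (T((i, j) \<mapsto> a, (i, Suc j) := None)) i (Suc j)
      | (None, Some b) \<Rightarrow> slide (T((i, j) \<mapsto> b, (Suc i, j) := None)) (Suc i) j
      | (Some a, Some b) \<Rightarrow>
          if a < b then slide (T((i, j) \<mapsto> a, (i, Suc j) := None)) i (Suc j)
          else slide (T((i, j) \<mapsto> b, (Suc i, j) := None)) (Suc i) j)"

definition position :: "filling \<Rightarrow> nat \<Rightarrow> cell" where
  "position T m = (THE c. T c = Some m)"

definition jdt_delete :: "filling \<Rightarrow> nat \<Rightarrow> filling" where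
  "jdt_delete T m =
     (let (i, j) = position T m
      in map_option (\<lambda>x. if x > m then x - 1 else x) \<circ> slide (T((i, j) := None)) i j)"

fun minors :: "nat \<Rightarrow> filling \<Rightarrow> filling set" where
  "minors 0 T = {T}"
| "minors (Suc k) T = (\<Union>m\<in>ran T. minors k (jdt_delete T m))"

end

theory Submission imports Defs begin

text \<open>
  The entry \<open>n\<close> sits at one of the two corners \<open>(k - 1, k)\<close> and \<open>(k, k - 1)\<close>.  Suppose it is at
  the first one in \<open>T\<close> and at the second one in \<open>S\<close>, and consider the \<open>k\<close>-minors \<open>A\<close> of shape
  \<open>(k+1, k, \<dots>, k, k-1)\<close> whose maximum is at \<open>(0, k)\<close>.  In \<open>T\<close>, deleting the other entries of the
  last column from below lifts \<open>n\<close> to \<open>(0, k)\<close>; the last deletion can be made at \<open>(k - 1, k - 1)\<close>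
  or at \<open>(k, k - 2)\<close>, so both orders of \<open>A (k - 1, k - 1)\<close> and \<open>A (k, k - 2)\<close> occur.
  In \<open>S\<close>, a maximum outside the last column stays where it is as long as its cell survives; this
  forces \<open>n\<close> to be deleted itself and all other slides to end in the last column, and such slides
  either keep the order of the entries at \<open>(k - 1, k - 1)\<close> and \<open>(k, k - 2)\<close> or leave an entry at
  \<open>(k - 1, k - 1)\<close> that ends up as the maximum of the minor.  So only one order occurs.
\<close>

section \<open>Tableaux as strictly increasing fillings of finite down-sets\<close>

text \<open>Forgets that the entries are exactly \<open>{1..n}\<close> and that the domain comes
  from a partition, and merges rows and columns into the product order on cells. In this form the
  notion passes easily to a deletion.\<close>

definition tableau :: "filling \<Rightarrow> bool" where
  "tableau T \<longleftrightarrow> finite (dom T) \<and> inj_on T (dom T)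
     \<and> (\<forall>i j i' j'. (i', j') \<in> dom T \<longrightarrow> i \<le> i' \<longrightarrow> j \<le> j' \<longrightarrow> (i, j) \<in> dom T)
     \<and> (\<forall>i j i' j'. (i', j') \<in> dom T \<longrightarrow> i \<le> i' \<longrightarrow> j \<le> j' \<longrightarrow> (i, j) \<noteq> (i', j')
          \<longrightarrow> the (T (i, j)) < the (T (i', j')))"

lemma tableau_down: "tableau T \<Longrightarrow> (i', j') \<in> dom T \<Longrightarrow> i \<le> i' \<Longrightarrow> j \<le> j' \<Longrightarrow> (i, j) \<in> dom T"
  unfolding tableau_def by blast

lemma tableau_less:
  "tableau T \<Longrightarrow> (i', j') \<in> dom T \<Longrightarrow> i \<le> i' \<Longrightarrow> j \<le> j' \<Longrightarrow> (i, j) \<noteq> (i', j')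
    \<Longrightarrow> the (T (i, j)) < the (T (i', j'))"
  unfolding tableau_def by blast

lemma tableau_le:
  "tableau T \<Longrightarrow> (i', j') \<in> dom T \<Longrightarrow> i \<le> i' \<Longrightarrow> j \<le> j' \<Longrightarrow> the (T (i, j)) \<le> the (T (i', j'))"
  by (metis tableau_less order.refl less_imp_le)

lemma tableau_inj:
  "tableau T \<Longrightarrow> x \<in> dom T \<Longrightarrow> y \<in> dom T \<Longrightarrow> the (T x) = the (T y) \<Longrightarrow> x = y"
  unfolding tableau_def by (metis inj_onD domD option.sel)

text \<open>Two comparable cells \<open>(i, j)\<close> and \<open>(i', j')\<close> are compared
  through \<open>(i, j')\<close>, which is filled because the row lengths decrease: first along the
  row, then down the column.\<close>

lemma YT_tableau:
  assumes "T \<in> YT n"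
  shows "tableau T"
proof -
  obtain lam where lam: "is_partition lam n" "has_shape T lam" and inj: "inj_on T (dom T)"
    and rows: "rows_increasing T" and cols: "columns_increasing T"
    using assms unfolding YT_def by blast
  have dom: "dom T = {(i, j). i < length lam \<and> j < lam ! i}"
    using lam(2) by (simp add: has_shape_def young_diagram_def)
  have "dom T \<subseteq> (\<Union>i<length lam. {i} \<times> {..<lam ! i})"
    unfolding dom by auto
  then have fin: "finite (dom T)" by (rule finite_subset) auto
  have down: "(i, j) \<in> dom T" if "(i', j') \<in> dom T" "i \<le> i'" "j \<le> j'" for i j i' j'
  proof -
    have "lam ! i' \<le> lam ! i"
      using that lam(1) unfolding dom is_partition_def
      by (cases "i = i'") (auto simp: sorted_wrt_iff_nth_less)
    then show ?thesis using that unfolding dom by auto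
  qed
  have row_le: "the (T (i, j)) \<le> the (T (i, j'))" "j < j' \<Longrightarrow> the (T (i, j)) < the (T (i, j'))"
    if "(i, j') \<in> dom T" "j \<le> j'" for i j j'
  proof -
    have "(i, j) \<in> dom T" using down that by blast
    then show *: "j < j' \<Longrightarrow> the (T (i, j)) < the (T (i, j'))"
      using rows that unfolding rows_increasing_def by fastforce
    then show "the (T (i, j)) \<le> the (T (i, j'))" using that by (cases "j = j'") auto
  qed
  have col_le: "the (T (i, j)) \<le> the (T (i', j))" "i < i' \<Longrightarrow> the (T (i, j)) < the (T (i', j))"
    if "(i', j) \<in> dom T" "i \<le> i'" for i i' j
  proof -
    have "(i, j) \<in> dom T" using down that by blast
    then show *: "i < i' \<Longrightarrow> the (T (i, j)) < the (T (i', j))"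
      using cols that unfolding columns_increasing_def by fastforce
    then show "the (T (i, j)) \<le> the (T (i', j))" using that by (cases "i = i'") auto
  qed
  have "the (T (i, j)) < the (T (i', j'))"
    if "(i', j') \<in> dom T" "i \<le> i'" "j \<le> j'" "(i, j) \<noteq> (i', j')" for i j i' j'
  proof -
    have "(i, j') \<in> dom T" using down that by blast
    then have "the (T (i, j)) \<le> the (T (i, j'))" "j < j' \<Longrightarrow> the (T (i, j)) < the (T (i, j'))"
      using row_le that by blast+
    moreover have "the (T (i, j')) \<le> the (T (i', j'))" "i < i' \<Longrightarrow> the (T (i, j')) < the (T (i', j'))"
      using col_le that by blast+
    moreover have "i < i' \<or> j < j'" using that by auto
    ultimately show ?thesis by linarith
  qed
  with fin inj down show ?thesis unfolding tableau_def by blast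
qed

section \<open>Slide paths\<close>

text \<open>The cell whose entry would slide into \<open>c\<close>, with the case distinction of
  \<open>slide\<close>. The entry at \<open>c\<close> itself is never read, so the definition makes
  sense whether \<open>c\<close> is filled or empty.\<close>

definition next_cell :: "filling \<Rightarrow> cell \<Rightarrow> cell option" where
  "next_cell T c =
     (let r = (fst c, Suc (snd c)); b = (Suc (fst c), snd c)
      in if T r = None \<and> T b = None then None
         else if T b = None \<or> (T r \<noteq> None \<and> the (T r) < the (T b)) then Some r else Some b)"

text \<open>The route of the hole, computed in the unchanging filling \<open>T\<close> and not in
  the one that \<open>slide\<close> updates.\<close>

definition slide_path :: "filling \<Rightarrow> cell \<Rightarrow> cell set" where
  "slide_path T c = {c'. (c, c') \<in> {(x, y). next_cell T x = Some y}\<^sup>*}"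

text \<open>All moves of a slide at once. At the last cell of the route \<open>next_cell\<close> is
  \<open>None\<close>, so the bind empties that cell.\<close>

definition shift_along :: "cell set \<Rightarrow> filling \<Rightarrow> filling" where
  "shift_along P T x = (if x \<in> P then Option.bind (next_cell T x) T else T x)"

text \<open>The index of the antidiagonal. Each move of the hole raises it by one, which separates
  the cells already changed from those still to be read.\<close>

abbreviation depth :: "cell \<Rightarrow> nat" where
  "depth c \<equiv> fst c + snd c"

lemma next_cell_depth: "next_cell T x = Some y \<Longrightarrow> depth y = Suc (depth x)"
  by (auto simp: next_cell_def Let_def split: if_splits)

lemma next_cell_in_dom: "next_cell T x = Some y \<Longrightarrow> y \<in> dom T"
  by (auto simp: next_cell_def Let_def split: if_splits)

lemma next_cell_cases: "next_cell T (i, j) = Some y \<Longrightarrow> y = (i, Suc j) \<or> y = (Suc i, j)"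
  by (auto simp: next_cell_def Let_def split: if_splits)

lemma next_cell_None: "next_cell T (i, j) = None \<longleftrightarrow> (i, Suc j) \<notin> dom T \<and> (Suc i, j) \<notin> dom T"
  by (auto simp: next_cell_def Let_def domIff)

lemma next_cell_min:
  assumes "next_cell T (i, j) = Some y"
  shows "(i, Suc j) \<in> dom T \<Longrightarrow> the (T y) \<le> the (T (i, Suc j))"
    and "(Suc i, j) \<in> dom T \<Longrightarrow> the (T y) \<le> the (T (Suc i, j))"
  using assms by (auto simp: next_cell_def Let_def split: if_splits)

lemma slide_path_start: "c \<in> slide_path T c"
  by (simp add: slide_path_def)

lemma slide_path_next: "x \<in> slide_path T c \<Longrightarrow> next_cell T x = Some y \<Longrightarrow> y \<in> slide_path T c"
  by (auto simp: slide_path_def intro: rtrancl_into_rtrancl)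

lemma slide_path_depth: "x \<in> slide_path T c \<Longrightarrow> depth c \<le> depth x"
  unfolding slide_path_def mem_Collect_eq
  by (induction rule: rtrancl_induct) (auto dest: next_cell_depth)

lemma slide_path_step:
  assumes "next_cell T c = Some d"
  shows "slide_path T c = insert c (slide_path T d)"
  using assms unfolding slide_path_def
  by (auto elim: converse_rtranclE intro: converse_rtrancl_into_rtrancl)

lemma slide_path_stop: "next_cell T c = None \<Longrightarrow> slide_path T c = {c}"
  unfolding slide_path_def by (auto elim: converse_rtranclE)

lemma next_cell_cong:
  assumes "\<And>x. depth x > depth c \<Longrightarrow> T x = T' x"
  shows "next_cell T c = next_cell T' c"
  using assms[of "(fst c, Suc (snd c))"] assms[of "(Suc (fst c), snd c)"]
  by (simp add: next_cell_def Let_def)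

lemma slide_path_subset_cong:
  assumes "\<And>x. depth x > depth c \<Longrightarrow> T x = T' x"
  shows "slide_path T c \<subseteq> slide_path T' c"
proof
  fix x assume x: "x \<in> slide_path T c"
  then have "(c, x) \<in> {(x, y). next_cell T x = Some y}\<^sup>*" by (simp add: slide_path_def)
  then show "x \<in> slide_path T' c"
  proof (induction rule: rtrancl_induct)
    case base
    then show ?case by (rule slide_path_start)
  next
    case (step y z)
    have "next_cell T y = next_cell T' y"
      using assms slide_path_depth[OF step.IH] by (intro next_cell_cong) simp
    with step show ?case by (auto intro: slide_path_next)
  qed
qed

lemma slide_path_cong:
  assumes "\<And>x. depth x > depth c \<Longrightarrow> T x = T' x"
  shows "slide_path T c = slide_path T' c"
  using assms slide_path_subset_cong[of c T T'] slide_path_subset_cong[of c T' T] by force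

text \<open>A move changes only the old and the new position of the hole, while later moves read
  only deeper cells. Hence the route in the updated filling is the rest of the route in
  \<open>T\<close>. The induction is on the number of filled cells deeper than the hole.\<close>

lemma slide_eq_shift_along:
  assumes "finite (dom T)" and "T (i, j) = None"
  shows "slide T i j = shift_along (slide_path T (i, j)) T"
  using assms
proof (induction "card {c \<in> dom T. depth c > i + j}" arbitrary: T i j rule: less_induct)
  case less
  have step: "slide T' (fst d) (snd d) = shift_along (slide_path T (i, j)) T"
    if next_cell: "next_cell T (i, j) = Some d" and T': "T' = T((i, j) := T d, d := None)" for d T'
  proof -
    have depth_d: "depth d = Suc (i + j)" using next_cell_depth[OF next_cell] by simp
    have d_dom: "d \<in> dom T" using next_cell_in_dom[OF next_cell] .
    have fin: "finite (dom T')" unfolding T' using less.prems(1) by simp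
    have "d \<notin> dom T'" by (simp add: T')
    moreover have "c = (i, j) \<or> c \<in> dom T" if "c \<in> dom T'" for c
      using that d_dom unfolding domIff T' by (cases "c = d"; cases "c = (i, j)") simp_all
    ultimately have "{c \<in> dom T'. depth c > depth d} \<subseteq> {c \<in> dom T. depth c > i + j} - {d}"
      using depth_d by force
    moreover have "d \<in> {c \<in> dom T. depth c > i + j}"
      using depth_d d_dom by simp
    ultimately have "{c \<in> dom T'. depth c > depth d} \<subset> {c \<in> dom T. depth c > i + j}"
      by blast
    then have "card {c \<in> dom T'. depth c > depth d} < card {c \<in> dom T. depth c > i + j}"
      using less.prems(1) by (intro psubset_card_mono) auto
    then have "slide T' (fst d) (snd d) = shift_along (slide_path T' d) T'"
      using less.hyps[of T' "fst d" "snd d"] fin by (simp add: T')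
    also have path: "slide_path T' d = slide_path T d"
      using depth_d by (intro slide_path_cong) (auto simp: T')
    also have "shift_along (slide_path T d) T' = shift_along (slide_path T (i, j)) T"
    proof
      fix x
      show "shift_along (slide_path T d) T' x = shift_along (slide_path T (i, j)) T x"
      proof (cases "x \<in> slide_path T d")
        case True
        then have ge: "depth x \<ge> depth d" by (rule slide_path_depth)
        have "next_cell T' x = next_cell T x"
          using ge depth_d by (intro next_cell_cong) (auto simp: T')
        moreover have "T' y = T y" if "next_cell T x = Some y" for y
          using next_cell_depth[OF that] ge depth_d by (auto simp: T')
        ultimately show ?thesis
          using True slide_path_step[OF next_cell]
          by (cases "next_cell T x") (auto simp: shift_along_def)
      next
        case False
        then have "x \<noteq> d" using slide_path_start by blast
        then show ?thesis
          using False next_cell slide_path_step[OF next_cell] by (auto simp: shift_along_def T')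
      qed
    qed
    finally show ?thesis .
  qed
  show ?case
  proof (cases "next_cell T (i, j)")
    case None
    then have "slide T i j = T"
      by (subst slide.simps) (auto simp: next_cell_None domIff)
    moreover have "shift_along (slide_path T (i, j)) T = T"
      using None less.prems(2) by (auto simp: slide_path_stop shift_along_def)
    ultimately show ?thesis by simp
  next
    case (Some d)
    have "slide T i j = slide (T((i, j) := T d, d := None)) (fst d) (snd d)"
      using Some
      by (subst slide.simps) (auto simp: next_cell_def Let_def split: option.splits if_splits)
    with step[OF Some refl] show ?thesis by simp
  qed
qed

text \<open>A route without end would reach every depth, but it stays in the finite set
  \<open>insert c (dom T)\<close>.\<close>

lemma slide_path_end:
  assumes "finite (dom T)"
  shows "\<exists>q \<in> slide_path T c. next_cell T q = None"
proof (rule ccontr)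
  assume no_end: "\<not> ?thesis"
  have "\<exists>x \<in> slide_path T c. depth x \<ge> l" for l
  proof (induction l)
    case 0
    then show ?case using slide_path_start by blast
  next
    case (Suc l)
    then obtain x where x: "x \<in> slide_path T c" "depth x \<ge> l" by blast
    then obtain y where "next_cell T x = Some y" using no_end by auto
    with x show ?case using next_cell_depth slide_path_next
      by (metis Suc_le_mono)
  qed
  moreover have "finite (slide_path T c)"
  proof (rule finite_subset)
    show "slide_path T c \<subseteq> insert c (dom T)"
      unfolding slide_path_def by (auto elim!: rtranclE dest!: next_cell_in_dom)
  qed (use assms in simp)
  then have "depth x \<le> Max (depth ` slide_path T c)" if "x \<in> slide_path T c" for x
    using that by (intro Max_ge) auto
  ultimately show False by (meson le_trans not_less_eq_eq)
qed

text \<open>\<open>next_cell\<close> is a function, so two points reached from the same start lie on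
  one chain.\<close>

lemma slide_path_linear:
  assumes "x \<in> slide_path T c" "y \<in> slide_path T c"
  shows "y \<in> slide_path T x \<or> x \<in> slide_path T y"
proof -
  have "single_valued {(x, y). next_cell T x = Some y}" by (auto simp: single_valued_def)
  then show ?thesis
    using assms by (auto simp: slide_path_def dest: single_valued_confluent)
qed

lemma slide_path_end_unique:
  assumes "x \<in> slide_path T c" "next_cell T x = None" "y \<in> slide_path T c" "next_cell T y = None"
  shows "x = y"
  using slide_path_linear[OF assms(1,3)] assms(2,4) by (auto simp: slide_path_stop)

lemma slide_path_depth_inj:
  assumes "x \<in> slide_path T c" "y \<in> slide_path T c" "depth x = depth y"
  shows "x = y"
proof -
  have "depth x < depth y" if "y \<in> slide_path T x" "x \<noteq> y" for x y
  proof (cases "next_cell T x")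
    case None
    then show ?thesis using that by (simp add: slide_path_stop)
  next
    case (Some z)
    then have "y \<in> slide_path T z" using that slide_path_step[OF Some] by simp
    then show ?thesis using slide_path_depth next_cell_depth[OF Some] by fastforce
  qed
  then show ?thesis using slide_path_linear[OF assms(1,2)] assms(3) by (metis less_irrefl)
qed

section \<open>A single deletion\<close>

definition removed :: "nat \<Rightarrow> nat \<Rightarrow> nat" where
  "removed m x = (if x > m then x - 1 else x)"

lemma removed_mono: "x \<le> y \<Longrightarrow> removed m x \<le> removed m y"
  by (auto simp: removed_def)

text \<open>\<open>removed m\<close> identifies \<open>m\<close> with \<open>m + 1\<close>;
  strictness is claimed away from the deleted entry.\<close>

lemma removed_strict_mono: "x < y \<Longrightarrow> x \<noteq> m \<Longrightarrow> y \<noteq> m \<Longrightarrow> removed m x < removed m y"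
  by (auto simp: removed_def)

lemma position_eq:
  assumes "tableau T" and "T p = Some m"
  shows "position T m = p"
  unfolding position_def
  using assms by (intro the_equality) (auto dest: tableau_inj simp: domIff)

text \<open>Emptying \<open>p\<close> before the slide changes nothing that the slide reads, since
  all its reads are deeper than \<open>p\<close>.\<close>

lemma jdt_delete_apply:
  assumes "tableau T" and "T p = Some m"
  shows "jdt_delete T m x = map_option (removed m) (shift_along (slide_path T p) T x)"
proof -
  have "position T m = p" using assms by (rule position_eq)
  let ?T = "T(p := None)"
  have fin: "finite (dom ?T)" using assms(1) by (simp add: tableau_def)
  have path: "slide_path ?T p = slide_path T p"
    by (intro slide_path_cong) auto
  have "shift_along (slide_path T p) ?T x = shift_along (slide_path T p) T x"
  proof (cases "x \<in> slide_path T p")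
    case True
    then have ge: "depth x \<ge> depth p" by (rule slide_path_depth)
    have "next_cell ?T x = next_cell T x"
      using ge by (intro next_cell_cong) auto
    moreover have "?T y = T y" if "next_cell T x = Some y" for y
      using next_cell_depth[OF that] ge by auto
    ultimately show ?thesis
      using True by (cases "next_cell T x") (auto simp: shift_along_def)
  next
    case False
    then show ?thesis using slide_path_start[of p T] by (auto simp: shift_along_def)
  qed
  then show ?thesis
    using slide_eq_shift_along[OF fin, of "fst p" "snd p"] \<open>position T m = p\<close>
    by (auto simp: jdt_delete_def path removed_def[abs_def] split: prod.split)
qed

text \<open>Interface to the deletion of \<open>m\<close>: \<open>P\<close> is the route of the hole
  and \<open>q\<close> its end, the cell that leaves the shape. The later general arguments use only
  these facts and never unfold the slide.\<close>

locale jdt_path =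
  fixes T :: filling and m :: nat and P :: "cell set" and q :: cell
  assumes T: "tableau T" and m: "m \<in> ran T"
    and sub: "P \<subseteq> dom T" and stop: "q \<in> P" "next_cell T q = None"
    and entry: "T x = Some m \<Longrightarrow> x \<in> P"
    and uniq: "x \<in> P \<Longrightarrow> next_cell T x = None \<Longrightarrow> x = q"
    and closed: "x \<in> P \<Longrightarrow> next_cell T x = Some y \<Longrightarrow> y \<in> P"
    and dom: "dom (jdt_delete T m) = dom T - {q}"
    and off: "x \<in> dom T \<Longrightarrow> x \<notin> P \<Longrightarrow> the (jdt_delete T m x) = removed m (the (T x))"
    and on: "x \<in> P \<Longrightarrow> next_cell T x = Some y \<Longrightarrow>
               the (jdt_delete T m x) = removed m (the (T y))"
    and ne: "x \<in> P \<Longrightarrow> next_cell T x = Some y \<Longrightarrow> the (T y) \<noteq> m"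
    and depth_inj: "x \<in> P \<Longrightarrow> y \<in> P \<Longrightarrow> depth x = depth y \<Longrightarrow> x = y"

lemma jdt_path_exists:
  assumes "tableau T" and "m \<in> ran T"
  shows "\<exists>P q. jdt_path T m P q"
proof -
  obtain p where p: "T p = Some m" using assms(2) by (auto simp: ran_def)
  let ?P = "slide_path T p"
  have fin: "finite (dom T)" using assms(1) by (simp add: tableau_def)
  obtain q where q: "q \<in> ?P" "next_cell T q = None" using slide_path_end[OF fin] by blast
  have sub: "?P \<subseteq> dom T"
    using p unfolding slide_path_def by (auto elim!: rtranclE dest!: next_cell_in_dom)
  have app: "jdt_delete T m x = map_option (removed m) (shift_along ?P T x)" for x
    using jdt_delete_apply[OF assms(1) p] .
  have uniq: "x = q" if "x \<in> ?P" "next_cell T x = None" for x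
    using slide_path_end_unique that q by blast
  have nx: "the (jdt_delete T m x) = removed m (the (T y))" "x \<in> dom (jdt_delete T m)"
    if "x \<in> ?P" "next_cell T x = Some y" for x y
    using that next_cell_in_dom[OF that(2)] by (auto simp: app shift_along_def)
  have off: "jdt_delete T m x = map_option (removed m) (T x)" if "x \<notin> ?P" for x
    using that by (simp add: app shift_along_def)
  have dom: "dom (jdt_delete T m) = dom T - {q}"
  proof (intro set_eqI)
    fix x
    show "x \<in> dom (jdt_delete T m) \<longleftrightarrow> x \<in> dom T - {q}"
    proof (cases "x \<in> ?P")
      case True
      then have "x \<in> dom T" using sub by blast
      show ?thesis
      proof (cases "next_cell T x")
        case None
        then have "x = q" using uniq True by blast
        moreover have "jdt_delete T m x = None" using True None by (simp add: app shift_along_def)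
        ultimately show ?thesis by (simp add: domIff)
      next
        case (Some y)
        then have "x \<noteq> q" using q(2) by auto
        then show ?thesis using nx(2)[OF True Some] \<open>x \<in> dom T\<close> by blast
      qed
    next
      case False
      then have "x \<noteq> q" using q(1) by blast
      with off[OF False] show ?thesis by (simp add: domIff)
    qed
  qed
  \<comment> \<open>The entry \<open>m\<close> occurs only at the start \<open>p\<close>, and every
    cell \<open>y\<close> that follows on the route is deeper.\<close>
  have ne: "the (T y) \<noteq> m" if "x \<in> ?P" "next_cell T x = Some y" for x y
  proof
    assume "the (T y) = m"
    then have "y = p"
      using tableau_inj[OF assms(1)] next_cell_in_dom[OF that(2)] p by (metis domI option.sel)
    then show False using slide_path_depth[OF that(1)] next_cell_depth[OF that(2)] by simp
  qed
  have mem: "x \<in> ?P" if "T x = Some m" for x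
    using tableau_inj[OF assms(1), of x p] that p slide_path_start[of p T] by auto
  have off': "the (jdt_delete T m x) = removed m (the (T x))" if "x \<in> dom T" "x \<notin> ?P" for x
    using that off by auto
  have "jdt_path T m ?P q"
    by (rule jdt_path.intro[OF assms sub q mem uniq slide_path_next dom off' nx(1) ne
          slide_path_depth_inj])
  then show ?thesis by blast
qed

context jdt_path
begin

text \<open>The entry that ends at \<open>x\<close> comes from \<open>src x\<close>. For comparable
  cells the source of the smaller one is itself or the smaller of its two neighbours, so its entry
  is at most the old entry of the larger cell; entries that move into that cell only increase
  it.\<close>

lemma tableau_delete: "tableau (jdt_delete T m)"
proof -
  define src where "src x = (if x \<in> P then the (next_cell T x) else x)" for x
  have next_src: "next_cell T x = Some (src x)" if "x \<in> P" "x \<noteq> q" for x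
    using that uniq unfolding src_def by (cases "next_cell T x") auto
  have src: "src x \<in> dom T" "the (T (src x)) \<noteq> m"
    "the (jdt_delete T m x) = removed m (the (T (src x)))" if "x \<in> dom T" "x \<noteq> q" for x
  proof -
    have "src x \<in> dom T \<and> the (T (src x)) \<noteq> m
        \<and> the (jdt_delete T m x) = removed m (the (T (src x)))"
    proof (cases "x \<in> P")
      case True
      then show ?thesis
        using next_src[OF True that(2)] next_cell_in_dom ne on by blast
    next
      case False
      then have "T x \<noteq> Some m" using entry by blast
      then show ?thesis using False that off by (auto simp: src_def)
    qed
    then show "src x \<in> dom T" "the (T (src x)) \<noteq> m"
      "the (jdt_delete T m x) = removed m (the (T (src x)))" by auto
  qed
  have less_imp: "the (jdt_delete T m x) < the (jdt_delete T m y)"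
    if "x \<in> dom T" "x \<noteq> q" "y \<in> dom T" "y \<noteq> q" "the (T (src x)) < the (T (src y))" for x y
    using removed_strict_mono[OF that(5) src(2)[OF that(1,2)] src(2)[OF that(3,4)]]
      src(3)[OF that(1,2)] src(3)[OF that(3,4)] by simp
  \<comment> \<open>On the route equal sources give equal depths. A source of a cell in
    \<open>P\<close> lies in \<open>P\<close>, so it cannot be a cell outside
    \<open>P\<close>.\<close>
  have src_inj: "x = y" if "x \<noteq> q" "y \<noteq> q" "src x = src y" for x y
  proof (cases "x \<in> P \<longleftrightarrow> y \<in> P")
    case True
    then show ?thesis
      using that next_src depth_inj next_cell_depth
      by (cases "x \<in> P") (metis Suc_inject, simp add: src_def)
  next
    case False
    then show ?thesis using that next_src closed by (metis src_def)
  qed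
  \<comment> \<open>The route ends at a corner of the shape, so removing \<open>q\<close> keeps the
    domain a down-set.\<close>
  have down: "(i, j) \<in> dom T - {q}"
    if "(i', j') \<in> dom T - {q}" "i \<le> i'" "j \<le> j'" for i j i' j'
  proof -
    have "(i, j) \<in> dom T" using that tableau_down[OF T] by blast
    moreover have "(i, j) \<noteq> q"
    proof
      assume "(i, j) = q"
      then have "(i, Suc j) \<notin> dom T" "(Suc i, j) \<notin> dom T"
        using stop(2) next_cell_None by blast+
      moreover have "Suc i \<le> i' \<or> Suc j \<le> j'"
        using that \<open>(i, j) = q\<close> by (metis DiffE insertI1 le_antisym not_less_eq_eq)
      ultimately show False using tableau_down[OF T] that by blast
    qed
    ultimately show ?thesis by blast
  qed
  have "the (jdt_delete T m (i, j)) < the (jdt_delete T m (i', j'))"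
    if *: "(i', j') \<in> dom T - {q}" "i \<le> i'" "j \<le> j'" "(i, j) \<noteq> (i', j')" for i j i' j'
  proof (rule less_imp)
    show x: "(i, j) \<in> dom T" "(i, j) \<noteq> q" using down * by blast+
    show y: "(i', j') \<in> dom T" "(i', j') \<noteq> q" using * by blast+
    have le': "the (T (i', j')) \<le> the (T (src (i', j')))"
      "(i', j') \<in> P \<Longrightarrow> the (T (i', j')) < the (T (src (i', j')))"
    proof -
      show lt: "the (T (i', j')) < the (T (src (i', j')))" if "(i', j') \<in> P"
      proof -
        have n: "next_cell T (i', j') = Some (src (i', j'))" using next_src y(2) that by blast
        show ?thesis
          using next_cell_cases[OF n]
          by (elim disjE; simp only:; intro tableau_less[OF T])
            (use next_cell_in_dom[OF n] in auto)
      qed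
      show "the (T (i', j')) \<le> the (T (src (i', j')))"
        using lt by (cases "(i', j') \<in> P") (auto simp: src_def)
    qed
    show "the (T (src (i, j))) < the (T (src (i', j')))"
    proof (cases "(i, j) \<in> P")
      case False
      then have "the (T (src (i, j))) < the (T (i', j'))"
        using tableau_less[OF T y(1)] * by (simp add: src_def)
      then show ?thesis using le'(1) by linarith
    next
      case True
      then have n: "next_cell T (i, j) = Some (src (i, j))" using next_src x(2) by blast
      have "Suc i \<le> i' \<or> Suc j \<le> j'" using * by auto
      then have "the (T (src (i, j))) \<le> the (T (i', j'))"
        using next_cell_min[OF n] tableau_le[OF T y(1)] tableau_down[OF T y(1)] *
        by (meson le_trans)
      \<comment> \<open>Strictness has two sources: if the larger cell is on the route, its entry
        grows strictly; if not, it differs from \<open>src (i, j)\<close>, which is on the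
        route.\<close>
      show ?thesis
      proof (cases "(i', j') \<in> P")
        case True
        then show ?thesis using le'(2) \<open>the (T (src (i, j))) \<le> _\<close> by linarith
      next
        case False
        then have "src (i, j) \<noteq> (i', j')" using closed[OF True n] by auto
        then have "the (T (src (i, j))) \<noteq> the (T (i', j'))"
          using tableau_inj[OF T] src(1)[OF x] y(1) by blast
        then show ?thesis using le'(1) \<open>the (T (src (i, j))) \<le> _\<close> by linarith
      qed
    qed
  qed
  moreover have "inj_on (jdt_delete T m) (dom T - {q})"
  proof (rule inj_onI)
    fix x y
    assume *: "x \<in> dom T - {q}" "y \<in> dom T - {q}" "jdt_delete T m x = jdt_delete T m y"
    then have "the (T (src x)) = the (T (src y))"
      using less_imp[of x y] less_imp[of y x] by (metis DiffE insertI1 less_irrefl linorder_neqE_nat)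
    then have "src x = src y" using tableau_inj[OF T] src(1) * by blast
    then show "x = y" using src_inj * by blast
  qed
  moreover have "finite (dom T - {q})" using T by (simp add: tableau_def)
  ultimately show ?thesis unfolding tableau_def dom using down by blast
qed

end

section \<open>The cell of the maximum under deletions\<close>

text \<open>The maximum is followed by its cell because its value is renumbered by each
  deletion.\<close>

definition max_at :: "filling \<Rightarrow> cell \<Rightarrow> bool" where
  "max_at T c \<longleftrightarrow> c \<in> dom T \<and> (\<forall>x \<in> dom T. the (T x) \<le> the (T c))"

lemma max_at_unique: "tableau T \<Longrightarrow> max_at T c \<Longrightarrow> max_at T d \<Longrightarrow> c = d"
  unfolding max_at_def by (metis tableau_inj le_antisym)

lemma max_at_next_cell:
  assumes "tableau T" "max_at T c"
  shows "next_cell T c = None"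
proof (cases "next_cell T c")
  case (Some y)
  obtain i j where c: "c = (i, j)" by (cases c)
  have y: "y \<in> dom T" using next_cell_in_dom[OF Some] .
  have "the (T c) < the (T y)"
    using next_cell_cases[of T i j y] Some y tableau_less[OF assms(1)] unfolding c by fastforce
  moreover have "the (T y) \<le> the (T c)" using assms(2) y unfolding max_at_def by blast
  ultimately show ?thesis by simp
qed

context jdt_path
begin

lemma delete_le_max:
  assumes "max_at T c" "x \<in> dom (jdt_delete T m)"
  shows "the (jdt_delete T m x) \<le> removed m (the (T c))"
proof -
  have x: "x \<in> dom T" "x \<noteq> q" using assms(2) dom by auto
  show ?thesis
  proof (cases "x \<in> P")
    case True
    then obtain y where y: "next_cell T x = Some y" using uniq x(2) by (cases "next_cell T x") auto
    then have "the (T y) \<le> the (T c)"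
      using next_cell_in_dom assms(1) by (auto simp: max_at_def)
    then show ?thesis using on[OF True y] removed_mono by simp
  next
    case False
    have "the (T x) \<le> the (T c)" using x assms(1) by (auto simp: max_at_def)
    then show ?thesis using off[OF x(1) False] removed_mono by simp
  qed
qed

text \<open>The cell of the maximum has no successor. On the route it would be the end
  \<open>q\<close> and disappear; so if it survives, its entry has not moved.\<close>

lemma max_at_delete:
  assumes c: "max_at T c" and "c \<in> dom (jdt_delete T m)"
  shows "max_at (jdt_delete T m) c"
proof -
  have "c \<notin> P" using uniq max_at_next_cell[OF T c] assms(2) dom by blast
  then have "the (jdt_delete T m c) = removed m (the (T c))"
    using off assms(2) dom by blast
  then show ?thesis using delete_le_max[OF c] assms(2) by (simp add: max_at_def)
qed

end

lemma jdt_delete_tableau: "tableau T \<Longrightarrow> m \<in> ran T \<Longrightarrow> tableau (jdt_delete T m)"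
  using jdt_path_exists jdt_path.tableau_delete by blast

lemma jdt_delete_dom: "tableau T \<Longrightarrow> m \<in> ran T \<Longrightarrow> dom (jdt_delete T m) \<subseteq> dom T"
  using jdt_path_exists jdt_path.dom by blast

lemma max_at_jdt_delete:
  "tableau T \<Longrightarrow> m \<in> ran T \<Longrightarrow> max_at T c \<Longrightarrow> c \<in> dom (jdt_delete T m) \<Longrightarrow>
    max_at (jdt_delete T m) c"
  using jdt_path_exists jdt_path.max_at_delete by blast

lemma jdt_delete_le_max:
  "tableau T \<Longrightarrow> m \<in> ran T \<Longrightarrow> max_at T c \<Longrightarrow> x \<in> dom (jdt_delete T m) \<Longrightarrow>
    the (jdt_delete T m x) \<le> removed m (the (T c))"
  using jdt_path_exists jdt_path.delete_le_max by blast

lemma minors_dom: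
  "tableau T \<Longrightarrow> A \<in> minors l T \<Longrightarrow> tableau A \<and> dom A \<subseteq> dom T"
proof (induction l arbitrary: T)
  case (Suc l)
  then obtain m where m: "m \<in> ran T" "A \<in> minors l (jdt_delete T m)" by auto
  then have "tableau A \<and> dom A \<subseteq> dom (jdt_delete T m)"
    using Suc jdt_delete_tableau by blast
  moreover have "dom (jdt_delete T m) \<subseteq> dom T"
    using Suc.prems(1) m(1) by (rule jdt_delete_dom)
  ultimately show ?case by blast
qed simp

text \<open>Domains only shrink, so a cell of \<open>A\<close> has survived every single
  deletion.\<close>

lemma max_at_minors:
  "tableau T \<Longrightarrow> max_at T c \<Longrightarrow> A \<in> minors l T \<Longrightarrow> c \<in> dom A \<Longrightarrow> max_at A c"
proof (induction l arbitrary: T)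
  case (Suc l)
  then obtain m where m: "m \<in> ran T" "A \<in> minors l (jdt_delete T m)" by auto
  have tab: "tableau (jdt_delete T m)" using Suc.prems(1) m(1) by (rule jdt_delete_tableau)
  then have "c \<in> dom (jdt_delete T m)" using minors_dom m(2) Suc.prems(4) by blast
  then show ?case
    using Suc.IH[OF tab _ m(2) Suc.prems(4)] max_at_jdt_delete[OF Suc.prems(1) m(1) Suc.prems(2)]
    by blast
qed simp

text \<open>\<open>minors\<close> splits off the first deletion; the construction in
  \<open>T\<close> chooses the last one.\<close>

lemma minors_Suc_last: "A \<in> minors l T \<Longrightarrow> m \<in> ran A \<Longrightarrow> jdt_delete A m \<in> minors (Suc l) T"
proof (induction l arbitrary: T)
  case (Suc l)
  then obtain m' where "m' \<in> ran T" "A \<in> minors l (jdt_delete T m')" by auto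
  then show ?case using Suc.IH Suc.prems(2) by (subst minors.simps) blast
qed auto

text \<open>The case of a slide with exactly one move, from \<open>y\<close> to \<open>x\<close>.
  All deletions chosen explicitly in \<open>T\<close> are of this kind.\<close>

lemma jdt_delete_next:
  assumes T: "tableau T" and x: "x \<in> dom T" "next_cell T x = Some y" and y: "next_cell T y = None"
    and m: "m = the (T x)"
  shows "m \<in> ran T" "dom (jdt_delete T m) = dom T - {y}"
    "the (jdt_delete T m x) = removed m (the (T y))"
    "\<And>z. z \<in> dom T \<Longrightarrow> z \<noteq> x \<Longrightarrow> z \<noteq> y \<Longrightarrow>
       the (jdt_delete T m z) = removed m (the (T z)) \<and> the (T z) \<noteq> m"
proof -
  have Tx: "T x = Some m" using x(1) m by auto
  then show "m \<in> ran T" by (rule ranI)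
  have "slide_path T x = {x, y}"
    using slide_path_step[OF x(2)] slide_path_stop[OF y] by simp
  then have app: "jdt_delete T m z = map_option (removed m)
      (if z = x then T y else if z = y then None else T z)" for z
    using jdt_delete_apply[OF T Tx, of z] x(2) y by (auto simp: shift_along_def)
  have y_dom: "y \<in> dom T" using next_cell_in_dom[OF x(2)] .
  have "x \<noteq> y" using x(2) y by auto
  show "dom (jdt_delete T m) = dom T - {y}"
    using y_dom x(1) \<open>x \<noteq> y\<close> by (intro set_eqI) (simp add: app domIff)
  show "the (jdt_delete T m x) = removed m (the (T y))"
    using y_dom by (auto simp: app)
  show "the (jdt_delete T m z) = removed m (the (T z)) \<and> the (T z) \<noteq> m"
    if "z \<in> dom T" "z \<noteq> x" "z \<noteq> y" for z
  proof
    show "the (T z) \<noteq> m" using that(2) tableau_inj[OF T that(1) x(1)] unfolding m by blast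
    show "the (jdt_delete T m z) = removed m (the (T z))"
      using that option.map_sel[of "T z" "removed m"] unfolding domIff by (simp add: app)
  qed
qed

lemma next_cell_right: "(i, Suc j) \<in> dom T \<Longrightarrow> (Suc i, j) \<notin> dom T \<Longrightarrow> next_cell T (i, j) = Some (i, Suc j)"
  by (auto simp: next_cell_def Let_def domIff)

lemma next_cell_below: "(Suc i, j) \<in> dom T \<Longrightarrow> (i, Suc j) \<notin> dom T \<Longrightarrow> next_cell T (i, j) = Some (Suc i, j)"
  by (auto simp: next_cell_def Let_def domIff)

section \<open>The shapes and the two critical cells\<close>

text \<open>From here on \<open>k = l + 2\<close>.\<close>

definition punctured_square :: "nat \<Rightarrow> cell set" where
  "punctured_square l = {(i, j). i \<le> l + 2 \<and> j \<le> l + 2 \<and> (i, j) \<noteq> (l + 2, l + 2)}"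

text \<open>A rectangle with \<open>l + 3\<close> rows and \<open>l + 2\<close> columns, and the
  last column filled down to row \<open>a\<close>. For \<open>a = l + 1\<close> this is the
  punctured square, for \<open>a = 0\<close> the shape \<open>(k+1, k, ..., k)\<close>.\<close>

definition partial_column :: "nat \<Rightarrow> nat \<Rightarrow> cell set" where
  "partial_column l a = {(i, j). i \<le> l + 2 \<and> j \<le> l + 1} \<union> {(i, j). i \<le> a \<and> j = l + 2}"

text \<open>
  This is what a slide produces if it reverses the order of the entries at \<open>(l + 1, l + 1)\<close> and
  \<open>(l + 2, l)\<close>.  Once \<open>(l + 2, l + 1)\<close> is gone, the maximum is stuck at one of these two cells.
\<close>

definition corner_heavy :: "nat \<Rightarrow> filling \<Rightarrow> bool" where
  "corner_heavy l T \<longleftrightarrow> (l + 1, l + 1) \<in> dom T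
     \<and> (\<forall>x \<in> dom T - {(l + 2, l + 1)}. the (T x) \<le> the (T (l + 1, l + 1)))"

section \<open>Minors of \<open>T\<close>: both orders occur\<close>

text \<open>Deleting the entry just above the maximum in the last column lifts the maximum by one
  row, because nothing lies to the right of that column. This is done \<open>a\<close>
  times.\<close>

lemma max_climbs_column:
  assumes "tableau T" "dom T = partial_column l a" "max_at T (a, l + 2)" "a \<le> l + 1"
  shows "\<exists>V \<in> minors a T. tableau V \<and> dom V = partial_column l 0 \<and> max_at V (0, l + 2)"
  using assms
proof (induction a arbitrary: T)
  case (Suc a)
  let ?x = "(a, l + 2)" and ?y = "(Suc a, l + 2)"
  define m where "m = the (T ?x)"
  have x: "?x \<in> dom T" and ny: "next_cell T ?y = None"
    unfolding next_cell_None Suc.prems(2) using Suc.prems(4) by (auto simp: partial_column_def)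
  have nx: "next_cell T ?x = Some ?y"
    using Suc.prems(4) by (intro next_cell_below) (simp_all add: Suc.prems(2) partial_column_def)
  note del = jdt_delete_next[OF Suc.prems(1) x nx ny m_def]
  have "dom (jdt_delete T m) = partial_column l a"
    unfolding del(2) Suc.prems(2) by (auto simp: partial_column_def)
  moreover have "max_at (jdt_delete T m) ?x"
    unfolding max_at_def del(3)
    using jdt_delete_le_max[OF Suc.prems(1) del(1) Suc.prems(3)] x del(2) by auto
  ultimately show ?case
    using Suc.IH[OF jdt_delete_tableau[OF Suc.prems(1) del(1)]] Suc.prems(4) del(1) by auto
qed auto

text \<open>Both critical cells have \<open>(l + 2, l + 1)\<close> as their only neighbour to the
  right or below. Deleting the entry at \<open>x\<close> pulls in the entry from there, which
  exceeds the entry at \<open>x'\<close>.\<close>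

lemma split_corner:
  assumes V: "tableau V" and dom: "dom V = partial_column l 0" and max: "max_at V (0, l + 2)"
    and x: "x = (l + 1, l + 1) \<and> x' = (l + 2, l) \<or> x = (l + 2, l) \<and> x' = (l + 1, l + 1)"
  shows "\<exists>m \<in> ran V. dom (jdt_delete V m) = partial_column l 0 - {(l + 2, l + 1)}
    \<and> max_at (jdt_delete V m) (0, l + 2)
    \<and> the (jdt_delete V m x') < the (jdt_delete V m x)"
proof -
  let ?e = "(l + 2, l + 1)"
  define m where "m = the (V x)"
  have x_dom: "x \<in> dom V" and x'_dom: "x' \<in> dom V" "x' \<noteq> x" "x' \<noteq> ?e" and e: "?e \<in> dom V"
    using x unfolding dom partial_column_def by auto
  have nx: "next_cell V x = Some ?e"
    using x
  proof
    assume "x = (l + 1, l + 1) \<and> x' = (l + 2, l)"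
    then show ?thesis using next_cell_below[of "l + 1" "l + 1" V] by (simp add: dom partial_column_def)
  next
    assume "x = (l + 2, l) \<and> x' = (l + 1, l + 1)"
    then show ?thesis using next_cell_right[of "l + 2" "l" V] by (simp add: dom partial_column_def)
  qed
  have ne: "next_cell V ?e = None"
    by (simp add: dom partial_column_def next_cell_None)
  note del = jdt_delete_next[OF V x_dom nx ne m_def]
  have "the (V x') < the (V ?e)"
    using x x'_dom(3) tableau_less[OF V e, of "fst x'" "snd x'"] by auto
  moreover have "the (V ?e) \<noteq> m"
    using tableau_inj[OF V e x_dom] x m_def by auto
  ultimately have "the (jdt_delete V m x') < the (jdt_delete V m x)"
    using removed_strict_mono del(3) del(4)[OF x'_dom] by simp
  moreover have "max_at (jdt_delete V m) (0, l + 2)"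
    using max_at_jdt_delete[OF V del(1) max] del(2) dom by (simp add: partial_column_def)
  ultimately show ?thesis using del(1,2) dom by (intro bexI[of _ m]) simp_all
qed

section \<open>Minors of \<open>S\<close>: only one order occurs\<close>

text \<open>A slide that draws an entry out of \<open>?e\<close> would put the maximum at
  \<open>?d\<close> or \<open>?f\<close>, which is excluded. So \<open>?f\<close> keeps its entry,
  and \<open>?d\<close> can only receive the larger entry of \<open>?g\<close>. This preserves
  \<open>?f\<close> below \<open>?d\<close>, and it can reverse the other order only by making the
  result corner heavy.\<close>

lemma jdt_delete_corner_step:
  assumes U: "tableau U" and m: "m \<in> ran U" and shape: "dom U \<subseteq> punctured_square l"
    and max_e: "(l + 2, l + 1) \<in> dom U \<Longrightarrow> max_at U (l + 2, l + 1)"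
    and d: "(l + 1, l + 1) \<in> dom (jdt_delete U m)" and f: "(l + 2, l) \<in> dom (jdt_delete U m)"
    and not_d: "\<not> max_at (jdt_delete U m) (l + 1, l + 1)"
    and not_f: "\<not> max_at (jdt_delete U m) (l + 2, l)"
  shows "corner_heavy l U \<Longrightarrow> corner_heavy l (jdt_delete U m)"
    and "the (U (l + 2, l)) < the (U (l + 1, l + 1)) \<Longrightarrow>
           the (jdt_delete U m (l + 2, l)) < the (jdt_delete U m (l + 1, l + 1))"
    and "the (U (l + 1, l + 1)) < the (U (l + 2, l)) \<Longrightarrow> \<not> corner_heavy l (jdt_delete U m) \<Longrightarrow>
           the (jdt_delete U m (l + 1, l + 1)) < the (jdt_delete U m (l + 2, l))"
proof -
  let ?U = "jdt_delete U m"
  let ?d = "(l + 1, l + 1)" and ?e = "(l + 2, l + 1)" and ?f = "(l + 2, l)" and ?g = "(l + 1, l + 2)"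
  obtain P q where "jdt_path U m P q" using jdt_path_exists[OF U m] by blast
  then interpret jdt_path U m P q .
  have tab: "tableau ?U" using U m by (rule jdt_delete_tableau)
  have next_ne_e: "next_cell U x \<noteq> Some ?e" if "x \<in> P" for x
  proof
    assume nx: "next_cell U x = Some ?e"
    then have max: "max_at U ?e" using max_e next_cell_in_dom by blast
    have "x \<in> dom ?U" using that sub dom stop(2) nx by (metis DiffI option.distinct(1) singletonD subsetD)
    then have "max_at ?U x"
      using jdt_delete_le_max[OF U m max] on[OF that nx] unfolding max_at_def by simp
    moreover have "x = ?d \<or> x = ?f"
      using next_cell_cases[of U "fst x" "snd x" ?e] nx by (cases x) auto
    ultimately show False using not_d not_f by blast
  qed
  have next_Some: "\<exists>y. next_cell U x = Some y" if "x \<in> P" "x \<in> dom ?U" for x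
    using uniq that dom by (cases "next_cell U x") auto
  \<comment> \<open>From the bottom row the route can only go on to \<open>?e\<close>; and it cannot
    stop at \<open>?f\<close>, which survives.\<close>
  have f_off: "?f \<notin> P"
  proof
    assume fP: "?f \<in> P"
    then obtain y where y: "next_cell U ?f = Some y" using next_Some f by blast
    have "y = ?e"
      using next_cell_cases[OF y] next_cell_in_dom[OF y] shape by (auto simp: punctured_square_def)
    then show False using next_ne_e fP y by blast
  qed
  have df: "?d \<in> dom U" "?f \<in> dom U" using d f dom by auto
  have f_val: "the (?U ?f) = removed m (the (U ?f))" "the (U ?f) \<noteq> m"
    using off[OF df(2) f_off] entry[of ?f] f_off df(2) by auto
  have d_on: "next_cell U ?d = Some ?g \<and> the (?U ?d) = removed m (the (U ?g)) \<and> the (U ?g) \<noteq> m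
      \<and> ?g \<in> dom U \<and> the (U ?d) < the (U ?g)" if dP: "?d \<in> P"
  proof -
    obtain y where y: "next_cell U ?d = Some y" using next_Some d dP by blast
    have "y \<noteq> ?e" using next_ne_e dP y by blast
    then have "y = ?g" using next_cell_cases[OF y] by auto
    then show ?thesis
      using y on[OF dP y] ne[OF dP y] next_cell_in_dom[OF y] tableau_less[OF U, of "l+1" "l+2" "l+1" "l+1"]
      by simp
  qed
  have d_off: "the (?U ?d) = removed m (the (U ?d))" "the (U ?d) \<noteq> m" if "?d \<notin> P"
    using off[OF df(1) that] entry[of ?d] that df(1) by auto
  show "corner_heavy l ?U" if heavy: "corner_heavy l U"
  proof -
    have le: "the (U x) \<le> the (U ?d)" if "x \<in> dom U" "x \<noteq> ?e" for x
      using heavy that unfolding corner_heavy_def by blast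
    \<comment> \<open>Otherwise \<open>?g\<close> would be filled with an entry above that of
      \<open>?d\<close>, against \<open>heavy\<close>.\<close>
    have dP: "?d \<notin> P"
      using d_on le[of ?g] by force
    have "the (?U x) \<le> the (?U ?d)" if x: "x \<in> dom ?U" "x \<noteq> ?e" for x
    proof (cases "x \<in> P")
      case True
      then obtain y where y: "next_cell U x = Some y" using next_Some x(1) by blast
      then have "y \<noteq> ?e" "y \<in> dom U" using next_ne_e True next_cell_in_dom by blast+
      then show ?thesis using le on[OF True y] d_off(1)[OF dP] removed_mono by simp
    next
      case False
      then show ?thesis using le[of x] x dom off d_off(1)[OF dP] removed_mono by simp
    qed
    then show ?thesis using d unfolding corner_heavy_def by blast
  qed
  show "the (?U ?f) < the (?U ?d)" if "the (U ?f) < the (U ?d)"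
    using that d_on d_off f_val by (cases "?d \<in> P") (auto intro!: removed_strict_mono)
  show "the (?U ?d) < the (?U ?f)" if less: "the (U ?d) < the (U ?f)" and light: "\<not> corner_heavy l ?U"
  proof (cases "?d \<in> P")
    case False
    then show ?thesis using less d_off f_val removed_strict_mono by simp
  next
    case True
    note g = d_on[OF True]
    have "the (U ?g) < the (U ?f)"
    proof (rule ccontr)
      \<comment> \<open>The route then runs through \<open>?d\<close> and ends at \<open>?g\<close>,
        whose entry moves to \<open>?d\<close>. The remaining cells other than \<open>?e\<close> are
        weakly northwest of \<open>?d\<close> or \<open>?f\<close>, or in the last column above
        \<open>?g\<close>; each has an entry at most the new one at \<open>?d\<close>, so the result
        is corner heavy.\<close>
      assume "\<not> ?thesis"
      then have fg: "the (?U ?f) \<le> the (?U ?d)" using f_val(1) g removed_mono by simp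
      have gP: "?g \<in> P" using closed True g by blast
      have "next_cell U ?g = None"
        using shape by (auto simp: next_cell_None punctured_square_def)
      then have "q = ?g" using uniq gP by blast
      have "the (?U x) \<le> the (?U ?d)" if x: "x \<in> dom ?U" "x \<noteq> ?e" for x
      proof -
        obtain i j where ij: "x = (i, j)" by (cases x)
        have "x \<in> punctured_square l" "x \<noteq> ?g" using x(1) dom shape \<open>q = ?g\<close> by auto
        then consider "i \<le> l + 1" "j \<le> l + 1" | "i \<le> l + 2" "j \<le> l" | "i \<le> l" "j = l + 2"
          using x(2) unfolding ij punctured_square_def by fastforce
        then show ?thesis
        proof cases
          case 1
          then show ?thesis using tableau_le[OF tab d] ij by simp
        next
          case 2
          then have "the (?U x) \<le> the (?U ?f)" using tableau_le[OF tab f] ij by simp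
          then show ?thesis using fg by simp
        next
          case 3
          show ?thesis
          proof (cases "x \<in> P")
            case True
            then obtain y where y: "next_cell U x = Some y" using next_Some x(1) by blast
            have "y = (Suc i, j)"
              using next_cell_cases[of U i j y] next_cell_in_dom[OF y] y shape 3
              by (auto simp: ij punctured_square_def)
            then have "the (U y) \<le> the (U ?g)" using tableau_le[OF U, of "l+1" "l+2"] g 3 by simp
            then show ?thesis using on[OF True y] g removed_mono by simp
          next
            case False
            have "the (U x) \<le> the (U ?g)" using tableau_le[OF U, of "l+1" "l+2"] g 3 ij by simp
            then show ?thesis using off[of x] False x(1) dom g removed_mono by simp
          qed
        qed
      qed
      then show False using light d unfolding corner_heavy_def by blast
    qed
    then show ?thesis using g f_val removed_strict_mono by simp
  qed
qed

text \<open>Induction on the number of deletions. That \<open>U\<close> is not corner heavy is part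
  of the claim because the order step needs it for the next filling. At the end it holds since, with
  \<open>(l + 2, l + 1)\<close> gone, a corner heavy \<open>A\<close> would have its maximum at
  \<open>(l + 1, l + 1)\<close>.\<close>

lemma minors_corner:
  assumes "tableau U" "dom U \<subseteq> punctured_square l"
    and "(l + 2, l + 1) \<in> dom U \<Longrightarrow> max_at U (l + 2, l + 1)"
    and "A \<in> minors r U"
    and "(l + 1, l + 1) \<in> dom A" "(l + 2, l) \<in> dom A" "(l + 2, l + 1) \<notin> dom A"
    and "\<not> max_at A (l + 1, l + 1)" "\<not> max_at A (l + 2, l)"
  shows "\<not> corner_heavy l U
    \<and> (the (U (l + 2, l)) < the (U (l + 1, l + 1)) \<longrightarrow> the (A (l + 2, l)) < the (A (l + 1, l + 1)))
    \<and> (the (U (l + 1, l + 1)) < the (U (l + 2, l)) \<longrightarrow> the (A (l + 1, l + 1)) < the (A (l + 2, l)))"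
  using assms(1-4)
proof (induction r arbitrary: U)
  case 0
  then show ?case using assms(5-9) by (auto simp: corner_heavy_def max_at_def)
next
  case (Suc r)
  then obtain m where m: "m \<in> ran U" and A: "A \<in> minors r (jdt_delete U m)" by auto
  let ?U = "jdt_delete U m"
  have tab: "tableau ?U" using Suc.prems(1) m by (rule jdt_delete_tableau)
  have dom: "dom A \<subseteq> dom ?U" using minors_dom[OF tab A] by blast
  have domU: "dom ?U \<subseteq> dom U" using Suc.prems(1) m by (rule jdt_delete_dom)
  \<comment> \<open>Both cells belong to \<open>A\<close>, so a maximum reached there earlier would
    still be there in \<open>A\<close>.\<close>
  have not_max: "\<not> max_at ?U (l + 1, l + 1)" "\<not> max_at ?U (l + 2, l)"
    using max_at_minors[OF tab _ A] assms(5,6,8,9) by blast+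
  have e: "max_at ?U (l + 2, l + 1)" if "(l + 2, l + 1) \<in> dom ?U"
    using that domU max_at_jdt_delete[OF Suc.prems(1) m Suc.prems(3)] by blast
  have "dom ?U \<subseteq> punctured_square l" using domU Suc.prems(2) by blast
  note IH = Suc.IH[OF tab this e A]
  have df: "(l + 1, l + 1) \<in> dom ?U" "(l + 2, l) \<in> dom ?U" using dom assms(5,6) by blast+
  note step = jdt_delete_corner_step[OF Suc.prems(1) m Suc.prems(2,3) df not_max]
  show ?case using IH step by blast
qed

section \<open>Distinguishing the two corners\<close>

text \<open>Two minors of \<open>T\<close> with a common predecessor \<open>V\<close> order
  \<open>?d\<close> and \<open>?f\<close> oppositely. Both are minors of \<open>S\<close> and would
  inherit the one order that these cells have in \<open>S\<close>.\<close>

lemma max_location_separated: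
  assumes T: "tableau T" "dom T = punctured_square l" "max_at T (l + 1, l + 2)"
    and S: "tableau S" "dom S = punctured_square l" "max_at S (l + 2, l + 1)"
    and minors: "minors (l + 2) S = minors (l + 2) T"
  shows False
proof -
  let ?d = "(l + 1, l + 1)" and ?e = "(l + 2, l + 1)" and ?f = "(l + 2, l)"
  have "dom T = partial_column l (l + 1)"
    unfolding T(2) by (auto simp: punctured_square_def partial_column_def)
  then obtain V where V: "V \<in> minors (l + 1) T" "tableau V" "dom V = partial_column l 0"
    "max_at V (0, l + 2)"
    using max_climbs_column[OF T(1) _ T(3)] by auto
  have fin: "(the (S ?f) < the (S ?d) \<longrightarrow> the (A ?f) < the (A ?d))
      \<and> (the (S ?d) < the (S ?f) \<longrightarrow> the (A ?d) < the (A ?f))"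
    if m: "m \<in> ran V" and A: "A = jdt_delete V m" "dom A = partial_column l 0 - {?e}"
      "max_at A (0, l + 2)" for m A
  proof -
    have A_minor: "A \<in> minors (l + 2) S"
      using minors_Suc_last[OF V(1) m] A(1) minors by simp
    have tab: "tableau A" using jdt_delete_tableau[OF V(2) m] A(1) by simp
    have "\<not> max_at A ?d" "\<not> max_at A ?f"
      using max_at_unique[OF tab A(3), of ?d] max_at_unique[OF tab A(3), of ?f] by auto
    moreover have "?d \<in> dom A" "?f \<in> dom A" "?e \<notin> dom A"
      unfolding A(2) by (auto simp: partial_column_def)
    ultimately show ?thesis
      using minors_corner[OF S(1) equalityD1[OF S(2)] S(3) A_minor] by blast
  qed
  obtain m where m: "m \<in> ran V" "dom (jdt_delete V m) = partial_column l 0 - {?e}"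
    "max_at (jdt_delete V m) (0, l + 2)" "the (jdt_delete V m ?f) < the (jdt_delete V m ?d)"
    using split_corner[OF V(2-4), of ?d ?f] by blast
  obtain m' where m': "m' \<in> ran V" "dom (jdt_delete V m') = partial_column l 0 - {?e}"
    "max_at (jdt_delete V m') (0, l + 2)" "the (jdt_delete V m' ?d) < the (jdt_delete V m' ?f)"
    using split_corner[OF V(2-4), of ?f ?d] by blast
  have "the (S ?d) \<noteq> the (S ?f)"
    using tableau_inj[OF S(1), of ?d ?f] S(2) by (auto simp: punctured_square_def)
  then show False
    using fin[OF m(1) refl m(2,3)] fin[OF m'(1) refl m'(2,3)] m(4) m'(4) by auto
qed

lemma young_diagram_punctured_square:
  "young_diagram (replicate (l + 2) (l + 2 + 1) @ [l + 2]) = punctured_square l"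
proof -
  have "young_diagram (replicate k (k + 1) @ [k]) = {(i, j). i \<le> k \<and> j \<le> k \<and> (i, j) \<noteq> (k, k)}" for k
    unfolding young_diagram_def by (auto simp: nth_append split: if_splits)
  then show ?thesis unfolding punctured_square_def .
qed

text \<open>The cell of \<open>n\<close> has no neighbour to the right or below, and the punctured
  square has just two such corners.\<close>

lemma punctured_square_max:
  assumes "T \<in> YT n" "n \<ge> 1" "dom T = punctured_square l"
  shows "position T n \<in> {(l + 1, l + 2), (l + 2, l + 1)} \<and> max_at T (position T n)"
proof -
  have T: "tableau T" using assms(1) by (rule YT_tableau)
  have ran: "ran T = {1..n}" using assms(1) by (simp add: YT_def)
  then have "n \<in> ran T" using assms(2) by simp
  then obtain c where c: "T c = Some n" by (auto simp: ran_def)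
  have pos: "position T n = c" using T c by (rule position_eq)
  have max: "max_at T c"
    unfolding max_at_def
  proof (intro conjI ballI)
    fix x assume "x \<in> dom T"
    then have "the (T x) \<in> ran T" by (auto intro: ranI)
    then show "the (T x) \<le> the (T c)" using ran c by simp
  qed (use c in blast)
  obtain i j where ij: "c = (i, j)" by (cases c)
  have "(i, Suc j) \<notin> dom T" "(Suc i, j) \<notin> dom T"
    using max_at_next_cell[OF T max] ij next_cell_None by blast+
  moreover have "(i, j) \<in> dom T" using c ij by blast
  ultimately have "c \<in> {(l + 1, l + 2), (l + 2, l + 1)}"
    unfolding ij assms(3) punctured_square_def by auto
  then show ?thesis using max pos by simp
qed

theorem theorem5p4:
  fixes k n :: nat and T :: filling
  assumes "k \<ge> 2"
    and "n = (k + 1)\<^sup>2 - 1"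
    and "T \<in> YT n"
    and "has_shape T (replicate k (k + 1) @ [k])"
  shows "\<forall>S. S \<in> YT n \<longrightarrow> has_shape S (replicate k (k + 1) @ [k]) \<longrightarrow> minors k S = minors k T
           \<longrightarrow> position S n = position T n"
proof (intro allI impI)
  fix S
  assume S: "S \<in> YT n" "has_shape S (replicate k (k + 1) @ [k])" and minors: "minors k S = minors k T"
  obtain l where l: "k = l + 2" using assms(1) by (metis add.commute le_Suc_ex)
  have "n \<ge> 1" using assms(1,2) by (simp add: power2_eq_square)
  moreover have dom: "dom T = punctured_square l" "dom S = punctured_square l"
    using assms(4) S(2) unfolding has_shape_def l young_diagram_punctured_square by auto
  ultimately have "position T n \<in> {(l + 1, l + 2), (l + 2, l + 1)} \<and> max_at T (position T n)"
    "position S n \<in> {(l + 1, l + 2), (l + 2, l + 1)} \<and> max_at S (position S n)"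
    using punctured_square_max assms(3) S(1) by blast+
  \<comment> \<open>The separation is used in both directions, according to which of the two
    tableaux has \<open>n\<close> in the last column.\<close>
  moreover note max_location_separated[of T l S] max_location_separated[of S l T]
  ultimately show "position S n = position T n"
    using YT_tableau assms(3) S(1) dom minors l by fastforce
qed

end
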